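(* Let $\mathcal{C}$ be a small category, let $\Sigma$ be a set of morphisms of $\mathcal{C}$ admitting a calculus of left fractions, and let $Q\colon\mathcal{C}\to\mathcal{C}[\Sigma^{-1}]$ be the localization functor. Let $X\colon\mathcal{C}\to\mathsf{S}$ be a functor to a category $\mathsf{S}$ such that for every object $B$ of $\mathcal{C}[\Sigma^{-1}]$ the functor $\chi_B\colon(Q\downarrow B)\to\mathcal{C}\xrightarrow{X}\mathsf{S}$ has a colimit in $\mathsf{S}$, and let $\operatorname{Lan}_Q X\colon\mathcal{C}[\Sigma^{-1}]\to\mathsf{S}$ be the resulting functor, with colimit cocone components $\eta^B_{(A,h)}\colon X(A)\to(\operatorname{Lan}_QX)(B)$. Let $g=[g_1,g_2]\colon B\to B'$ be a morphism of $\mathcal{C}[\Sigma^{-1}]$, represented by $g_1\colon B\to W$ in $\mathcal{C}$ and $g_2\colon B'\to W$ in $\Sigma$. Let $\epsilon\colon B\to A$ be in $\Sigma$, and let $g_1'\colon A\to Z$ in $\mathcal{C}$ and $\epsilon'\colon W\to Z$ in $\Sigma$ be such that $g_1'\circ\epsilon=\epsilon'\circ g_1$. Then $$(\operatorname{Lan}_Q X)([g_1,g_2])\circ\eta^{B}_{(A,[\mathrm{id}_A,\epsilon])}=\eta^{B'}_{(Z,[\mathrm{id}_Z,\,\epsilon'\circ g_2])}\circ X(g_1').$$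
   Context: Calculus of left fractions: $\Sigma$ satisfies (LF1) $\Sigma$ contains all identities and is closed under composition; (LF2) every pair $X'\xleftarrow{\tau}X\xrightarrow{g}Y$ with $\tau\in\Sigma$ can be completed to a commutative square $\sigma\circ g=f\circ\tau$ with $f\colon X'\to Y'$ in $\mathcal{C}$ and $\sigma\colon Y\to Y'$ in $\Sigma$; (LF3) if $f,g\colon X\to Y$ and $\sigma\colon X'\to X$ in $\Sigma$ satisfy $f\circ\sigma=g\circ\sigma$, then there is $\tau\colon Y\to Y'$ in $\Sigma$ with $\tau\circ f=\tau\circ g$. The localization $\mathcal{C}[\Sigma^{-1}]$ has the objects of $\mathcal{C}$. Its morphisms $X\to Y$ are equivalence classes $[f,\sigma]$ of left fractions $X\xrightarrow{f}Y'\xleftarrow{\sigma}Y$ with $\sigma\in\Sigma$, where $(f_1,\sigma_1)\sim(f_2,\sigma_2)$ if there are $p,q$ with $p\circ f_1=q\circ f_2$ and $p\circ\sigma_1=q\circ\sigma_2\in\Sigma$. Composition: $[g,\omega]\circ[f,\sigma]=[g'\circ f,\sigma'\circ\omega]$, where $g'\circ\sigma=\sigma'\circ g$ with $\sigma'\in\Sigma$. The functor $Q$ is the identity on objects and $f\mapsto[f,\mathrm{id}_{\mathrm{cod}(f)}]$ on morphisms. Objects of the comma category $(Q\downarrow B)$ are pairs $(A,h\colon Q(A)\to B)$; a morphism $(A,h)\to(A',h')$ is a morphism $f\colon A\to A'$ of $\mathcal{C}$ with $h'\circ Q(f)=h$. The functor $\chi_B$ sends $(A,h)$ to $X(A)$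 and $f$ to $X(f)$. The functor $\operatorname{Lan}_QX$ is the left Kan extension of $X$ along $Q$: $(\operatorname{Lan}_QX)(B)$ is the colimit of $\chi_B$, with cocone components $\eta^B_{(A,h)}$, and for $g\colon B\to B'$ the morphism $(\operatorname{Lan}_QX)(g)$ is the unique one satisfying $(\operatorname{Lan}_QX)(g)\circ\eta^B_{(A,h)}=\eta^{B'}_{(A,g\circ h)}$ for all $(A,h)$. *)

theory Defs
  imports Main
begin

text \<open>
  Categories have a set of objects and a set of arrows inside arbitrary types; operations are
  only constrained on these carriers.  Composition is written in function order:
  \<open>g \<cdot>\<^bsub>C\<^esub> f\<close> is ``first \<open>f\<close>, then \<open>g\<close>''.
\<close>

record ('o, 'm) cat =
  Ob :: "'o set"
  Mor :: "'m set"
  Dom :: "'m \<Rightarrow> 'o"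
  Cod :: "'m \<Rightarrow> 'o"
  Idt :: "'o \<Rightarrow> 'm"
  Comp :: "'m \<Rightarrow> 'm \<Rightarrow> 'm"  (infixr \<open>\<cdot>\<index>\<close> 70)

definition hom :: "('o, 'm) cat \<Rightarrow> 'o \<Rightarrow> 'o \<Rightarrow> 'm set" where
  "hom C X Y = {f \<in> Mor C. Dom C f = X \<and> Cod C f = Y}"

locale category =
  fixes C :: "('o, 'm) cat" (structure)
  assumes dom_in_Ob: "f \<in> Mor C \<Longrightarrow> Dom C f \<in> Ob C"
    and cod_in_Ob: "f \<in> Mor C \<Longrightarrow> Cod C f \<in> Ob C"
    and id_in_hom: "X \<in> Ob C \<Longrightarrow> Idt C X \<in> hom C X X"
    and comp_in_hom: "f \<in> hom C X Y \<Longrightarrow> g \<in> hom C Y Z \<Longrightarrow> g \<cdot> f \<in> hom C X Z"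
    and comp_id_right: "f \<in> hom C X Y \<Longrightarrow> f \<cdot> Idt C X = f"
    and comp_id_left: "f \<in> hom C X Y \<Longrightarrow> Idt C Y \<cdot> f = f"
    and comp_assoc: "f \<in> hom C W X \<Longrightarrow> g \<in> hom C X Y \<Longrightarrow> h \<in> hom C Y Z \<Longrightarrow>
      (h \<cdot> g) \<cdot> f = h \<cdot> (g \<cdot> f)"

record ('o1, 'm1, 'o2, 'm2) ftr =
  ob_map :: "'o1 \<Rightarrow> 'o2"
  mor_map :: "'m1 \<Rightarrow> 'm2"

locale is_functor = C: category C + D: category D
  for C :: "('o1, 'm1) cat" and D :: "('o2, 'm2) cat" +
  fixes F :: "('o1, 'm1, 'o2, 'm2) ftr"
  assumes ob_map_in_Ob: "X \<in> Ob C \<Longrightarrow> ob_map F X \<in> Ob D"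
    and mor_map_in_hom: "f \<in> hom C X Y \<Longrightarrow> mor_map F f \<in> hom D (ob_map F X) (ob_map F Y)"
    and mor_map_id: "X \<in> Ob C \<Longrightarrow> mor_map F (Idt C X) = Idt D (ob_map F X)"
    and mor_map_comp: "f \<in> hom C X Y \<Longrightarrow> g \<in> hom C Y Z \<Longrightarrow>
      mor_map F (g \<cdot>\<^bsub>C\<^esub> f) = mor_map F g \<cdot>\<^bsub>D\<^esub> mor_map F f"

definition ftr_comp ::
    "('o2, 'm2, 'o3, 'm3) ftr \<Rightarrow> ('o1, 'm1, 'o2, 'm2) ftr \<Rightarrow> ('o1, 'm1, 'o3, 'm3) ftr" where
  "ftr_comp G F = \<lparr>ob_map = ob_map G \<circ> ob_map F, mor_map = mor_map G \<circ> mor_map F\<rparr>"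


section \<open>Colimits\<close>

definition is_cocone ::
    "('i, 'j) cat \<Rightarrow> ('o, 'm) cat \<Rightarrow> ('i, 'j, 'o, 'm) ftr \<Rightarrow> 'o \<Rightarrow> ('i \<Rightarrow> 'm) \<Rightarrow> bool" where
  "is_cocone J S F c \<eta> \<longleftrightarrow>
     c \<in> Ob S \<and>
     (\<forall>j\<in>Ob J. \<eta> j \<in> hom S (ob_map F j) c) \<and>
     (\<forall>u\<in>Mor J. \<eta> (Cod J u) \<cdot>\<^bsub>S\<^esub> mor_map F u = \<eta> (Dom J u))"

definition is_colimit ::
    "('i, 'j) cat \<Rightarrow> ('o, 'm) cat \<Rightarrow> ('i, 'j, 'o, 'm) ftr \<Rightarrow> 'o \<Rightarrow> ('i \<Rightarrow> 'm) \<Rightarrow> bool" where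
  "is_colimit J S F c \<eta> \<longleftrightarrow>
     is_cocone J S F c \<eta> \<and>
     (\<forall>c' \<eta>'. is_cocone J S F c' \<eta>' \<longrightarrow>
        (\<exists>!u. u \<in> hom S c c' \<and> (\<forall>j\<in>Ob J. u \<cdot>\<^bsub>S\<^esub> \<eta> j = \<eta>' j)))"


section \<open>Calculus of left fractions and localization\<close>

locale left_fractions = category C
  for C :: "('o, 'm) cat" (structure) +
  fixes \<Sigma> :: "'m set"
  assumes subset_Mor: "\<Sigma> \<subseteq> Mor C"
    and LF1_id: "X \<in> Ob C \<Longrightarrow> Idt C X \<in> \<Sigma>"
    and LF1_comp: "\<sigma> \<in> \<Sigma> \<Longrightarrow> \<tau> \<in> \<Sigma> \<Longrightarrow> Cod C \<sigma> = Dom C \<tau> \<Longrightarrow> \<tau> \<cdot> \<sigma> \<in> \<Sigma>"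
    and LF2: "\<tau> \<in> \<Sigma> \<Longrightarrow> \<tau> \<in> hom C X X' \<Longrightarrow> g \<in> hom C X Y \<Longrightarrow>
      \<exists>Y' f \<sigma>. f \<in> hom C X' Y' \<and> \<sigma> \<in> hom C Y Y' \<and> \<sigma> \<in> \<Sigma> \<and> \<sigma> \<cdot> g = f \<cdot> \<tau>"
    and LF3: "f \<in> hom C X Y \<Longrightarrow> g \<in> hom C X Y \<Longrightarrow> \<sigma> \<in> \<Sigma> \<Longrightarrow> \<sigma> \<in> hom C X' X \<Longrightarrow>
      f \<cdot> \<sigma> = g \<cdot> \<sigma> \<Longrightarrow> \<exists>Y' \<tau>. \<tau> \<in> \<Sigma> \<and> \<tau> \<in> hom C Y Y' \<and> \<tau> \<cdot> f = \<tau> \<cdot> g"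

text \<open>
  A pair \<open>(f, \<sigma>)\<close> stands for \<open>X \<rightarrow> Y' \<leftarrow> Y\<close> with \<open>f : X \<rightarrow> Y'\<close> and \<open>\<sigma> : Y \<rightarrow> Y'\<close> in \<open>\<Sigma>\<close>; its source
  is \<open>X = Dom f\<close> and its target is \<open>Y = Dom \<sigma>\<close>.
\<close>

definition fracs :: "('o, 'm) cat \<Rightarrow> 'm set \<Rightarrow> ('m \<times> 'm) set" where
  "fracs C \<Sigma> = {(f, \<sigma>). f \<in> Mor C \<and> \<sigma> \<in> \<Sigma> \<and> Cod C f = Cod C \<sigma>}"

definition frac_rel :: "('o, 'm) cat \<Rightarrow> 'm set \<Rightarrow> (('m \<times> 'm) \<times> ('m \<times> 'm)) set" where
  "frac_rel C \<Sigma> = {((f1, \<sigma>1), (f2, \<sigma>2)).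
     (f1, \<sigma>1) \<in> fracs C \<Sigma> \<and> (f2, \<sigma>2) \<in> fracs C \<Sigma> \<and>
     Dom C f1 = Dom C f2 \<and> Dom C \<sigma>1 = Dom C \<sigma>2 \<and>
     (\<exists>Z p q. p \<in> hom C (Cod C f1) Z \<and> q \<in> hom C (Cod C f2) Z \<and>
        p \<cdot>\<^bsub>C\<^esub> f1 = q \<cdot>\<^bsub>C\<^esub> f2 \<and> p \<cdot>\<^bsub>C\<^esub> \<sigma>1 = q \<cdot>\<^bsub>C\<^esub> \<sigma>2 \<and> p \<cdot>\<^bsub>C\<^esub> \<sigma>1 \<in> \<Sigma>)}"

definition frac :: "('o, 'm) cat \<Rightarrow> 'm set \<Rightarrow> 'm \<Rightarrow> 'm \<Rightarrow> ('m \<times> 'm) set" where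
  "frac C \<Sigma> f \<sigma> = frac_rel C \<Sigma> `` {(f, \<sigma>)}"

text \<open>
  Source, target and composite of classes are given on representatives; under a calculus of left
  fractions they do not depend on the representatives nor on the completing square, so the
  descriptions below are well defined.
\<close>

definition localization :: "('o, 'm) cat \<Rightarrow> 'm set \<Rightarrow> ('o, ('m \<times> 'm) set) cat" where
  "localization C \<Sigma> = \<lparr>
     Ob = Ob C,
     Mor = fracs C \<Sigma> // frac_rel C \<Sigma>,
     Dom = (\<lambda>F. THE X. \<exists>(f, \<sigma>)\<in>F. X = Dom C f),
     Cod = (\<lambda>F. THE Y. \<exists>(f, \<sigma>)\<in>F. Y = Dom C \<sigma>),
     Idt = (\<lambda>X. frac C \<Sigma> (Idt C X) (Idt C X)),
     Comp = (\<lambda>G F. THE H. \<exists>(f, \<sigma>)\<in>F. \<exists>(g, \<omega>)\<in>G. \<exists>Z g' \<sigma>'.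
        g' \<in> hom C (Cod C \<sigma>) Z \<and> \<sigma>' \<in> hom C (Cod C g) Z \<and> \<sigma>' \<in> \<Sigma> \<and>
        g' \<cdot>\<^bsub>C\<^esub> \<sigma> = \<sigma>' \<cdot>\<^bsub>C\<^esub> g \<and> H = frac C \<Sigma> (g' \<cdot>\<^bsub>C\<^esub> f) (\<sigma>' \<cdot>\<^bsub>C\<^esub> \<omega>))\<rparr>"

definition loc_functor ::
    "('o, 'm) cat \<Rightarrow> 'm set \<Rightarrow> ('o, 'm, 'o, ('m \<times> 'm) set) ftr" where
  "loc_functor C \<Sigma> =
     \<lparr>ob_map = (\<lambda>A. A), mor_map = (\<lambda>f. frac C \<Sigma> f (Idt C (Cod C f)))\<rparr>"


section \<open>Comma categories and left Kan extensions\<close>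

text \<open>
  The category \<open>(Q \<down> B)\<close> for \<open>Q : C \<rightarrow> D\<close>; an arrow is stored together with its source and target.
\<close>

definition comma ::
    "('o, 'm) cat \<Rightarrow> ('p, 'n) cat \<Rightarrow> ('o, 'm, 'p, 'n) ftr \<Rightarrow> 'p \<Rightarrow>
     ('o \<times> 'n, ('o \<times> 'n) \<times> 'm \<times> ('o \<times> 'n)) cat" where
  "comma C D Q B =
     (let obs = {(A, h). A \<in> Ob C \<and> h \<in> hom D (ob_map Q A) B} in
      \<lparr>Ob = obs,
       Mor = {((A, h), f, (A', h')) | A h f A' h'.
         (A, h) \<in> obs \<and> (A', h') \<in> obs \<and> f \<in> hom C A A' \<and> h' \<cdot>\<^bsub>D\<^esub> mor_map Q f = h},
       Dom = (\<lambda>(x, f, y). x),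
       Cod = (\<lambda>(x, f, y). y),
       Idt = (\<lambda>(A, h). ((A, h), Idt C A, (A, h))),
       Comp = (\<lambda>(_, g, z) (x, f, _). (x, g \<cdot>\<^bsub>C\<^esub> f, z))\<rparr>)"

definition comma_proj :: "('o \<times> 'n, ('o \<times> 'n) \<times> 'm \<times> ('o \<times> 'n), 'o, 'm) ftr" where
  "comma_proj = \<lparr>ob_map = (\<lambda>(A, h). A), mor_map = (\<lambda>(x, f, y). f)\<rparr>"

text \<open>
  The diagram \<open>\<chi>\<^sub>B : (Q \<down> B) \<rightarrow> C \<rightarrow> S\<close>; its action does not mention \<open>Q\<close> or \<open>B\<close>, which enter only
  through the index category.
\<close>

definition chi ::
    "('o, 'm, 'a, 'b) ftr \<Rightarrow> ('o \<times> 'n, ('o \<times> 'n) \<times> 'm \<times> ('o \<times> 'n), 'a, 'b) ftr" where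
  "chi X = ftr_comp X comma_proj"

text \<open>\<open>L B\<close> with components \<open>\<eta> B (A, h)\<close> is a choice of colimit of \<open>\<chi>\<^sub>B\<close> for each object \<open>B\<close>.\<close>

definition is_colimit_choice ::
    "('o, 'm) cat \<Rightarrow> ('p, 'n) cat \<Rightarrow> ('a, 'b) cat \<Rightarrow> ('o, 'm, 'p, 'n) ftr \<Rightarrow>
     ('o, 'm, 'a, 'b) ftr \<Rightarrow> ('p \<Rightarrow> 'a) \<Rightarrow> ('p \<Rightarrow> 'o \<times> 'n \<Rightarrow> 'b) \<Rightarrow> bool" where
  "is_colimit_choice C D S Q X L \<eta> \<longleftrightarrow>
     (\<forall>B\<in>Ob D. is_colimit (comma C D Q B) S (chi X) (L B) (\<eta> B))"

definition lan ::
    "('o, 'm) cat \<Rightarrow> ('p, 'n) cat \<Rightarrow> ('a, 'b) cat \<Rightarrow> ('o, 'm, 'p, 'n) ftr \<Rightarrow>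
     ('p \<Rightarrow> 'a) \<Rightarrow> ('p \<Rightarrow> 'o \<times> 'n \<Rightarrow> 'b) \<Rightarrow> ('p, 'n, 'a, 'b) ftr" where
  "lan C D S Q L \<eta> =
     \<lparr>ob_map = L,
      mor_map = (\<lambda>g. THE u. u \<in> hom S (L (Dom D g)) (L (Cod D g)) \<and>
        (\<forall>(A, h)\<in>Ob (comma C D Q (Dom D g)).
           u \<cdot>\<^bsub>S\<^esub> \<eta> (Dom D g) (A, h) = \<eta> (Cod D g) (A, g \<cdot>\<^bsub>D\<^esub> h)))\<rparr>"

end

theory Submission
  imports Defs
begin

text \<open>
  Both sides equal \<open>\<eta>\<^bsub>(A, [g1', \<epsilon>' g2])\<^esub>\<close>.  The given square computes \<open>[g1, g2] \<circ> [id, \<epsilon>]\<close> as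
  \<open>[g1', \<epsilon>' g2]\<close>, which is also \<open>[id, \<epsilon>' g2] \<circ> Q(g1')\<close>, so \<open>g1'\<close> is an arrow of the comma category
  over \<open>B'\<close> and the cocone identity applies.  What makes \<open>Lan\<close> well defined on arrows is only the
  special case \<open>g \<circ> (h \<circ> Q(f)) = (g \<circ> h) \<circ> Q(f)\<close> of associativity in the localization.
\<close>

section \<open>Left fractions, their relation, and completing squares\<close>

lemma homD: "f \<in> hom C X Y \<Longrightarrow> f \<in> Mor C \<and> Dom C f = X \<and> Cod C f = Y"
  by (simp add: hom_def)

context left_fractions
begin

lemma comp_in_Sigma:
  "\<sigma> \<in> hom C X Y \<Longrightarrow> \<sigma> \<in> \<Sigma> \<Longrightarrow> \<tau> \<in> hom C Y Z \<Longrightarrow> \<tau> \<in> \<Sigma> \<Longrightarrow> \<tau> \<cdot> \<sigma> \<in> \<Sigma>"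
  by (simp add: LF1_comp hom_def)

lemma hom_Ob:
  assumes "f \<in> hom C X Y"
  shows "X \<in> Ob C" "Y \<in> Ob C"
  using assms dom_in_Ob cod_in_Ob by (auto simp: hom_def)

lemma frac_relI:
  assumes "f1 \<in> hom C X V1" "\<sigma>1 \<in> hom C Y V1" "\<sigma>1 \<in> \<Sigma>"
    and "f2 \<in> hom C X V2" "\<sigma>2 \<in> hom C Y V2" "\<sigma>2 \<in> \<Sigma>"
    and "p \<in> hom C V1 Z" "q \<in> hom C V2 Z"
    and "p \<cdot> f1 = q \<cdot> f2" "p \<cdot> \<sigma>1 = q \<cdot> \<sigma>2" "p \<cdot> \<sigma>1 \<in> \<Sigma>"
  shows "((f1, \<sigma>1), (f2, \<sigma>2)) \<in> frac_rel C \<Sigma>"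
proof -
  have cod: "Cod C f1 = V1" "Cod C f2 = V2" using assms(1,4) by (auto dest: homD)
  have "(f1, \<sigma>1) \<in> fracs C \<Sigma>" "(f2, \<sigma>2) \<in> fracs C \<Sigma>" "Dom C f1 = Dom C f2" "Dom C \<sigma>1 = Dom C \<sigma>2"
    using assms(1-6) by (auto simp: fracs_def hom_def)
  \<comment> \<open>The definition speaks of \<open>Cod C f1\<close> and \<open>Cod C f2\<close>;
    rewriting \<open>V1\<close> and \<open>V2\<close> back to these lets the witnesses
    match.\<close>
  then show ?thesis
    using assms(7-11) unfolding frac_rel_def cod[symmetric] by blast
qed

lemma fracs_hom:
  assumes "(f, \<sigma>) \<in> fracs C \<Sigma>"
  shows "f \<in> hom C (Dom C f) (Cod C f)" "\<sigma> \<in> hom C (Dom C \<sigma>) (Cod C f)" "\<sigma> \<in> \<Sigma>"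
  using assms subset_Mor by (auto simp: fracs_def hom_def)

text \<open>Only the first fraction has to be typed: the relation forces its source and target on
  the second one, whose middle object \<open>V2\<close> is returned with the witnesses.\<close>

lemma frac_relE:
  assumes rel: "((f1, \<sigma>1), (f2, \<sigma>2)) \<in> frac_rel C \<Sigma>"
    and f1: "f1 \<in> hom C X V1" and \<sigma>1: "\<sigma>1 \<in> hom C Y V1"
  obtains V2 Z p q where
    "f2 \<in> hom C X V2" "\<sigma>2 \<in> hom C Y V2" "\<sigma>2 \<in> \<Sigma>"
    "p \<in> hom C V1 Z" "q \<in> hom C V2 Z"
    "p \<cdot> f1 = q \<cdot> f2" "p \<cdot> \<sigma>1 = q \<cdot> \<sigma>2" "p \<cdot> \<sigma>1 \<in> \<Sigma>"
proof -
  have fr: "(f2, \<sigma>2) \<in> fracs C \<Sigma>" and dom: "Dom C f2 = X" "Dom C \<sigma>2 = Y"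
    using rel homD[OF f1] homD[OF \<sigma>1] unfolding frac_rel_def by auto
  obtain Z p q where pq: "p \<in> hom C V1 Z" "q \<in> hom C (Cod C f2) Z"
    "p \<cdot> f1 = q \<cdot> f2" "p \<cdot> \<sigma>1 = q \<cdot> \<sigma>2" "p \<cdot> \<sigma>1 \<in> \<Sigma>"
    using rel homD[OF f1] unfolding frac_rel_def by auto
  show thesis
    using that[OF fracs_hom[OF fr, unfolded dom] pq] .
qed

lemma ore_square:
  assumes "\<sigma> \<in> hom C X Y" "\<sigma> \<in> \<Sigma>" "m \<in> hom C X Y'"
  obtains V a b where "a \<in> hom C Y V" "b \<in> hom C Y' V" "b \<in> \<Sigma>" "b \<cdot> m = a \<cdot> \<sigma>"
  using LF2[OF assms(2,1,3)] by blast

lemma equalized_square: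
  assumes \<sigma>: "\<sigma> \<in> hom C Y Y'" "\<sigma> \<in> \<Sigma>"
    and f: "f \<in> hom C Y' U" and g: "g \<in> hom C Y' U"
    and eq: "f \<cdot> \<sigma> = g \<cdot> \<sigma>"
  obtains V c where "c \<in> hom C U V" "c \<in> \<Sigma>" "c \<cdot> f = c \<cdot> g"
  using LF3[OF f g \<sigma>(2,1) eq] by blast

text \<open>
  The second factorization \<open>k \<sigma> = m g\<close> need not have \<open>m\<close> in \<open>\<Sigma>\<close>; this generality lets one lemma handle
  both a change of the completing square and a change of representative of \<open>[g, \<omega>]\<close>.
\<close>
lemma frac_rel_comp_squares:
  assumes f: "f \<in> hom C X Y'" and \<sigma>: "\<sigma> \<in> hom C Y Y'" "\<sigma> \<in> \<Sigma>"
    and g: "g \<in> hom C Y Z'" and \<omega>: "\<omega> \<in> hom C Z Z'" "\<omega> \<in> \<Sigma>"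
    and g': "g' \<in> hom C Y' V" and \<sigma>': "\<sigma>' \<in> hom C Z' V" "\<sigma>' \<in> \<Sigma>" and sq: "g' \<cdot> \<sigma> = \<sigma>' \<cdot> g"
    and k: "k \<in> hom C Y' U" and m: "m \<in> hom C Z' U" "m \<cdot> \<omega> \<in> \<Sigma>" and sq': "k \<cdot> \<sigma> = m \<cdot> g"
  shows "((g' \<cdot> f, \<sigma>' \<cdot> \<omega>), (k \<cdot> f, m \<cdot> \<omega>)) \<in> frac_rel C \<Sigma>"
proof -
  \<comment> \<open>The vertices \<open>V\<close> and \<open>U\<close> are joined by completing the
    span of \<open>\<sigma>'\<close> and \<open>m\<close> out of \<open>Z'\<close>. This settles the
    denominators at once, for any \<open>\<omega>\<close>.\<close>
  obtain T a b where a: "a \<in> hom C V T" and b: "b \<in> hom C U T" "b \<in> \<Sigma>"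
    and ab: "b \<cdot> m = a \<cdot> \<sigma>'"
    using ore_square[OF \<sigma>' m(1)] .
  have "(a \<cdot> g') \<cdot> \<sigma> = a \<cdot> (\<sigma>' \<cdot> g)"
    by (simp add: comp_assoc[OF \<sigma>(1) g' a] sq)
  also have "\<dots> = (b \<cdot> m) \<cdot> g"
    by (simp add: comp_assoc[OF g \<sigma>'(1) a, symmetric] ab)
  also have "\<dots> = (b \<cdot> k) \<cdot> \<sigma>"
    by (simp add: comp_assoc[OF g m(1) b(1)] comp_assoc[OF \<sigma>(1) k b(1)] sq')
  finally have eq: "(a \<cdot> g') \<cdot> \<sigma> = (b \<cdot> k) \<cdot> \<sigma>" .
  \<comment> \<open>On the numerator side \<open>a \<cdot> g'\<close> and \<open>b \<cdot> k\<close>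
    agree only after precomposition with \<open>\<sigma>\<close>. LF3 trades this for
    postcomposition with \<open>c\<close>, so \<open>c \<cdot> a\<close> and
    \<open>c \<cdot> b\<close> become the witnesses.\<close>
  obtain R c where c: "c \<in> hom C T R" "c \<in> \<Sigma>" and cab: "c \<cdot> (a \<cdot> g') = c \<cdot> (b \<cdot> k)"
    using equalized_square[OF \<sigma> comp_in_hom[OF g' a] comp_in_hom[OF k b(1)] eq] .
  have ca: "c \<cdot> a \<in> hom C V R" and cb: "c \<cdot> b \<in> hom C U R"
    using a b c comp_in_hom by blast+
  have cbS: "c \<cdot> b \<in> \<Sigma>" using comp_in_Sigma[OF b c] .
  have "(c \<cdot> a) \<cdot> (g' \<cdot> f) = (c \<cdot> (a \<cdot> g')) \<cdot> f"
    by (simp add: comp_assoc[OF f g' ca, symmetric] comp_assoc[OF g' a c(1)])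
  also have "\<dots> = (c \<cdot> b) \<cdot> (k \<cdot> f)"
    by (simp add: cab comp_assoc[OF f k cb, symmetric] comp_assoc[OF k b(1) c(1)])
  finally have 1: "(c \<cdot> a) \<cdot> (g' \<cdot> f) = (c \<cdot> b) \<cdot> (k \<cdot> f)" .
  have "(c \<cdot> a) \<cdot> (\<sigma>' \<cdot> \<omega>) = (c \<cdot> (a \<cdot> \<sigma>')) \<cdot> \<omega>"
    by (simp add: comp_assoc[OF \<omega>(1) \<sigma>'(1) ca, symmetric] comp_assoc[OF \<sigma>'(1) a c(1)])
  also have "\<dots> = (c \<cdot> b) \<cdot> (m \<cdot> \<omega>)"
    by (simp add: ab[symmetric] comp_assoc[OF \<omega>(1) m(1) cb, symmetric] comp_assoc[OF m(1) b(1) c(1)])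
  finally have 2: "(c \<cdot> a) \<cdot> (\<sigma>' \<cdot> \<omega>) = (c \<cdot> b) \<cdot> (m \<cdot> \<omega>)" .
  \<comment> \<open>Membership in \<Sigma> is read off on this side: \<open>b\<close>,
    \<open>c\<close> and \<open>m \<cdot> \<omega>\<close> lie in \<Sigma>, whereas nothing of the
    kind is known for \<open>a\<close>.\<close>
  have "(c \<cdot> b) \<cdot> (m \<cdot> \<omega>) \<in> \<Sigma>"
    using comp_in_Sigma[OF comp_in_hom[OF \<omega>(1) m(1)] m(2) cb cbS] .
  with 1 2 show ?thesis
    using frac_relI[OF comp_in_hom[OF f g'] comp_in_hom[OF \<omega>(1) \<sigma>'(1)] comp_in_Sigma[OF \<omega> \<sigma>']
        comp_in_hom[OF f k] comp_in_hom[OF \<omega>(1) m(1)] m(2) ca cb] by simp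
qed

section \<open>The fraction relation is an equivalence\<close>

text \<open>The two refinements, with vertices \<open>Z\<close> and \<open>Z'\<close>, are
  amalgamated over \<open>V2\<close>. LF2 gives a square whose two routes from \<open>V2\<close>
  agree after \<open>\<sigma>2\<close>; LF3 then removes \<open>\<sigma>2\<close>.\<close>

lemma frac_rel_trans:
  assumes "((f1, \<sigma>1), (f2, \<sigma>2)) \<in> frac_rel C \<Sigma>" "((f2, \<sigma>2), (f3, \<sigma>3)) \<in> frac_rel C \<Sigma>"
  shows "((f1, \<sigma>1), (f3, \<sigma>3)) \<in> frac_rel C \<Sigma>"
proof -
  have "(f1, \<sigma>1) \<in> fracs C \<Sigma>" using assms(1) by (simp add: frac_rel_def)
  then obtain X Y V1 where f1: "f1 \<in> hom C X V1" and \<sigma>1: "\<sigma>1 \<in> hom C Y V1" "\<sigma>1 \<in> \<Sigma>"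
    using fracs_hom by blast
  obtain V2 Z p q where f2: "f2 \<in> hom C X V2" and \<sigma>2: "\<sigma>2 \<in> hom C Y V2" "\<sigma>2 \<in> \<Sigma>"
    and p: "p \<in> hom C V1 Z" and q: "q \<in> hom C V2 Z"
    and pq: "p \<cdot> f1 = q \<cdot> f2" "p \<cdot> \<sigma>1 = q \<cdot> \<sigma>2" "p \<cdot> \<sigma>1 \<in> \<Sigma>"
    using frac_relE[OF assms(1) f1 \<sigma>1(1)] .
  obtain V3 Z' p' q' where f3: "f3 \<in> hom C X V3" and \<sigma>3: "\<sigma>3 \<in> hom C Y V3" "\<sigma>3 \<in> \<Sigma>"
    and p': "p' \<in> hom C V2 Z'" and q': "q' \<in> hom C V3 Z'"
    and pq': "p' \<cdot> f2 = q' \<cdot> f3" "p' \<cdot> \<sigma>2 = q' \<cdot> \<sigma>3" "p' \<cdot> \<sigma>2 \<in> \<Sigma>"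
    using frac_relE[OF assms(2) f2 \<sigma>2(1)] .
  \<comment> \<open>LF2 needs a leg in \<Sigma>; \<open>q \<cdot> \<sigma>2\<close> qualifies
    because it equals \<open>p \<cdot> \<sigma>1\<close>.\<close>
  have s: "q \<cdot> \<sigma>2 \<in> hom C Y Z" "q \<cdot> \<sigma>2 \<in> \<Sigma>" using comp_in_hom[OF \<sigma>2(1) q] pq by auto
  have t: "p' \<cdot> \<sigma>2 \<in> hom C Y Z'" using comp_in_hom[OF \<sigma>2(1) p'] .
  obtain T a b where a: "a \<in> hom C Z T" and b: "b \<in> hom C Z' T" "b \<in> \<Sigma>"
    and ab: "b \<cdot> (p' \<cdot> \<sigma>2) = a \<cdot> (q \<cdot> \<sigma>2)"
    using ore_square[OF s t] .
  have "(a \<cdot> q) \<cdot> \<sigma>2 = (b \<cdot> p') \<cdot> \<sigma>2"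
    by (simp add: comp_assoc[OF \<sigma>2(1) q a] comp_assoc[OF \<sigma>2(1) p' b(1)] ab)
  then obtain R c where c: "c \<in> hom C T R" "c \<in> \<Sigma>" and cab: "c \<cdot> (a \<cdot> q) = c \<cdot> (b \<cdot> p')"
    using equalized_square[OF \<sigma>2 comp_in_hom[OF q a] comp_in_hom[OF p' b(1)]] by blast
  define m n where "m = c \<cdot> a" and "n = c \<cdot> b"
  have m: "m \<in> hom C Z R" and n: "n \<in> hom C Z' R" "n \<in> \<Sigma>"
    using comp_in_hom[OF a c(1)] comp_in_hom[OF b(1) c(1)] comp_in_Sigma[OF b c]
    by (auto simp: m_def n_def)
  have mn: "m \<cdot> q = n \<cdot> p'"
    by (simp add: m_def n_def comp_assoc[OF q a c(1)] comp_assoc[OF p' b(1) c(1)] cab)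
  \<comment> \<open>Stated for an arbitrary triple with common source \<open>K\<close>, so that one
    computation serves both numerators and denominators.\<close>
  have glue: "(m \<cdot> p) \<cdot> x1 = (n \<cdot> q') \<cdot> x3"
    if "x1 \<in> hom C K V1" "x2 \<in> hom C K V2" "x3 \<in> hom C K V3"
      "p \<cdot> x1 = q \<cdot> x2" "p' \<cdot> x2 = q' \<cdot> x3" for K x1 x2 x3
  proof -
    have "(m \<cdot> p) \<cdot> x1 = (m \<cdot> q) \<cdot> x2"
      by (simp add: comp_assoc[OF that(1) p m] comp_assoc[OF that(2) q m] that)
    also have "\<dots> = (n \<cdot> q') \<cdot> x3"
      by (simp add: mn comp_assoc[OF that(2) p' n(1)] comp_assoc[OF that(3) q' n(1)] that)
    finally show ?thesis .
  qed
  \<comment> \<open>The composite equals \<open>n \<cdot> (p' \<cdot> \<sigma>2)\<close>, a product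
    of members of \<Sigma>; only \<open>n\<close>, not \<open>m\<close>, is known to lie in
    \<Sigma>.\<close>
  have "(n \<cdot> q') \<cdot> \<sigma>3 \<in> \<Sigma>"
    using comp_in_Sigma[OF t pq'(3) n] by (simp add: comp_assoc[OF \<sigma>3(1) q' n(1)] pq')
  then show ?thesis
    using glue[OF f1 f2 f3 pq(1) pq'(1)] glue[OF \<sigma>1(1) \<sigma>2(1) \<sigma>3(1) pq(2) pq'(2)]
      frac_relI[OF f1 \<sigma>1 f3 \<sigma>3 comp_in_hom[OF p m] comp_in_hom[OF q' n(1)]] by simp
qed

lemma frac_rel_refl:
  assumes f: "f \<in> hom C X V" and \<sigma>: "\<sigma> \<in> hom C Y V" "\<sigma> \<in> \<Sigma>"
  shows "((f, \<sigma>), (f, \<sigma>)) \<in> frac_rel C \<Sigma>"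
  using frac_relI[OF f \<sigma> f \<sigma> id_in_hom id_in_hom] hom_Ob(2)[OF f] \<sigma> comp_id_left[OF \<sigma>(1)]
  by simp

lemma frac_rel_sym:
  assumes "((f1, \<sigma>1), (f2, \<sigma>2)) \<in> frac_rel C \<Sigma>"
  shows "((f2, \<sigma>2), (f1, \<sigma>1)) \<in> frac_rel C \<Sigma>"
proof -
  have "(f1, \<sigma>1) \<in> fracs C \<Sigma>" using assms by (simp add: frac_rel_def)
  note h1 = fracs_hom[OF this]
  obtain V Z p q where h2: "f2 \<in> hom C (Dom C f1) V" "\<sigma>2 \<in> hom C (Dom C \<sigma>1) V" "\<sigma>2 \<in> \<Sigma>"
    and pq: "p \<in> hom C (Cod C f1) Z" "q \<in> hom C V Z"
      "p \<cdot> f1 = q \<cdot> f2" "p \<cdot> \<sigma>1 = q \<cdot> \<sigma>2" "p \<cdot> \<sigma>1 \<in> \<Sigma>"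
    using frac_relE[OF assms h1(1,2)] .
  then show ?thesis using frac_relI[OF h2 h1 pq(2,1)] by simp
qed

lemma equiv_frac_rel: "equiv (fracs C \<Sigma>) (frac_rel C \<Sigma>)"
proof (rule equivI)
  show "frac_rel C \<Sigma> \<subseteq> fracs C \<Sigma> \<times> fracs C \<Sigma>"
    unfolding frac_rel_def by auto
  show "refl_on (fracs C \<Sigma>) (frac_rel C \<Sigma>)"
  proof (rule refl_onI)
    fix x assume "x \<in> fracs C \<Sigma>"
    then show "(x, x) \<in> frac_rel C \<Sigma>"
      using frac_rel_refl[OF fracs_hom] by (cases x) auto
  qed
  show "sym (frac_rel C \<Sigma>)"
    by (auto intro: symI frac_rel_sym)
  show "trans (frac_rel C \<Sigma>)"
  proof (rule transI)
    fix x y z assume "(x, y) \<in> frac_rel C \<Sigma>" "(y, z) \<in> frac_rel C \<Sigma>"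
    then show "(x, z) \<in> frac_rel C \<Sigma>"
      using frac_rel_trans by (cases x; cases y; cases z) blast
  qed
qed

text \<open>One genuine fraction suffices: it belongs to its own class, so equality of the classes
  forces the other pair to be related to it.\<close>

lemma frac_eq_iff:
  assumes "f \<in> hom C X V" "\<sigma> \<in> hom C Y V" "\<sigma> \<in> \<Sigma>"
  shows "frac C \<Sigma> f \<sigma> = frac C \<Sigma> f' \<sigma>' \<longleftrightarrow> ((f, \<sigma>), (f', \<sigma>')) \<in> frac_rel C \<Sigma>"
proof -
  have "(f, \<sigma>) \<in> fracs C \<Sigma>" using assms by (auto simp: fracs_def hom_def)
  then have "frac C \<Sigma> f \<sigma> = frac C \<Sigma> f' \<sigma>' \<longleftrightarrow> ((f', \<sigma>'), (f, \<sigma>)) \<in> frac_rel C \<Sigma>"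
    unfolding frac_def using eq_equiv_class[OF _ equiv_frac_rel] equiv_class_eq[OF equiv_frac_rel]
    by metis
  then show ?thesis using frac_rel_sym by blast
qed

section \<open>Composition and homs in the localization\<close>

text \<open>Both representatives and the completing square change at once. A third square, built
  over the common refinements \<open>P\<close> and \<open>R\<close>, is compared with each of the
  two given ones; the resulting comparison fractions coincide literally.\<close>

lemma frac_rel_comp:
  assumes f: "f \<in> hom C X Y'" and \<sigma>: "\<sigma> \<in> hom C Y Y'" "\<sigma> \<in> \<Sigma>"
    and g: "g \<in> hom C Y Z'" and \<omega>: "\<omega> \<in> hom C Z Z'" "\<omega> \<in> \<Sigma>"
    and g': "g' \<in> hom C Y' V" and \<sigma>': "\<sigma>' \<in> hom C Z' V" "\<sigma>' \<in> \<Sigma>" and sq: "g' \<cdot> \<sigma> = \<sigma>' \<cdot> g"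
    and relf: "((f, \<sigma>), (e, \<rho>)) \<in> frac_rel C \<Sigma>" and relg: "((g, \<omega>), (h, \<tau>)) \<in> frac_rel C \<Sigma>"
    and h': "h' \<in> hom C (Cod C \<rho>) U" and \<tau>': "\<tau>' \<in> hom C (Cod C h) U" "\<tau>' \<in> \<Sigma>"
    and sq': "h' \<cdot> \<rho> = \<tau>' \<cdot> h"
  shows "((g' \<cdot> f, \<sigma>' \<cdot> \<omega>), (h' \<cdot> e, \<tau>' \<cdot> \<tau>)) \<in> frac_rel C \<Sigma>"
proof -
  obtain E P p q where e: "e \<in> hom C X E" and \<rho>: "\<rho> \<in> hom C Y E" "\<rho> \<in> \<Sigma>"
    and p: "p \<in> hom C Y' P" and q: "q \<in> hom C E P"
    and pq: "p \<cdot> f = q \<cdot> e" "p \<cdot> \<sigma> = q \<cdot> \<rho>" "p \<cdot> \<sigma> \<in> \<Sigma>"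
    using frac_relE[OF relf f \<sigma>(1)] .
  obtain H R r t where h: "h \<in> hom C Y H" and \<tau>: "\<tau> \<in> hom C Z H" "\<tau> \<in> \<Sigma>"
    and r: "r \<in> hom C Z' R" and t: "t \<in> hom C H R"
    and rt: "r \<cdot> g = t \<cdot> h" "r \<cdot> \<omega> = t \<cdot> \<tau>" "r \<cdot> \<omega> \<in> \<Sigma>"
    using frac_relE[OF relg g \<omega>(1)] .
  have [simp]: "Cod C \<rho> = E" "Cod C h = H" using \<rho> h by (auto dest: homD)
  \<comment> \<open>LF2 applies since \<open>p \<cdot> \<sigma>\<close> is in \<Sigma>. Neither
    \<open>b \<cdot> r\<close> nor \<open>b \<cdot> t\<close> need lie in \<Sigma>, only their
    composites with \<open>\<omega>\<close> and \<open>\<tau>\<close>;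
    \<open>frac_rel_comp_squares\<close> asks for no more.\<close>
  obtain T k b where k: "k \<in> hom C P T" and b: "b \<in> hom C R T" "b \<in> \<Sigma>"
    and kb: "b \<cdot> (r \<cdot> g) = k \<cdot> (p \<cdot> \<sigma>)"
    using ore_square[OF comp_in_hom[OF \<sigma>(1) p] pq(3) comp_in_hom[OF g r]] .
  have br: "b \<cdot> (r \<cdot> \<omega>) \<in> \<Sigma>"
    using comp_in_Sigma[OF comp_in_hom[OF \<omega>(1) r] rt(3) b] .
  have "((g' \<cdot> f, \<sigma>' \<cdot> \<omega>), ((k \<cdot> p) \<cdot> f, (b \<cdot> r) \<cdot> \<omega>)) \<in> frac_rel C \<Sigma>"
    using frac_rel_comp_squares[OF f \<sigma> g \<omega> g' \<sigma>' sq comp_in_hom[OF p k] comp_in_hom[OF r b(1)]]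
      br kb comp_assoc[OF \<omega>(1) r b(1)] comp_assoc[OF \<sigma>(1) p k] comp_assoc[OF g r b(1)] by simp
  moreover have "((h' \<cdot> e, \<tau>' \<cdot> \<tau>), ((k \<cdot> q) \<cdot> e, (b \<cdot> t) \<cdot> \<tau>)) \<in> frac_rel C \<Sigma>"
    using frac_rel_comp_squares[OF e \<rho> h \<tau> _ _ _ sq' comp_in_hom[OF q k] comp_in_hom[OF t b(1)]]
      h' \<tau>' br kb pq rt
      comp_assoc[OF \<tau>(1) t b(1)] comp_assoc[OF \<rho>(1) q k] comp_assoc[OF h t b(1)] by simp
  moreover have "(k \<cdot> p) \<cdot> f = (k \<cdot> q) \<cdot> e" "(b \<cdot> r) \<cdot> \<omega> = (b \<cdot> t) \<cdot> \<tau>"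
    using comp_assoc[OF f p k] comp_assoc[OF e q k] comp_assoc[OF \<omega>(1) r b(1)]
      comp_assoc[OF \<tau>(1) t b(1)] pq rt by simp_all
  ultimately show ?thesis
    using frac_rel_trans frac_rel_sym by metis
qed

text \<open>This evaluates the definite descriptions behind \<open>Dom\<close> and
  \<open>Cod\<close>: all members of a class share source and target, and reflexivity supplies a
  member.\<close>

lemma frac_in_hom:
  assumes f: "f \<in> hom C X V" and \<sigma>: "\<sigma> \<in> hom C Y V" "\<sigma> \<in> \<Sigma>"
  shows "frac C \<Sigma> f \<sigma> \<in> hom (localization C \<Sigma>) X Y"
proof -
  have mem: "(f, \<sigma>) \<in> frac C \<Sigma> f \<sigma>"
    using frac_rel_refl[OF assms] by (simp add: frac_def)
  have dc: "Dom C e = X \<and> Dom C \<rho> = Y" if "(e, \<rho>) \<in> frac C \<Sigma> f \<sigma>" for e \<rho>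
    using that f \<sigma> by (auto simp: frac_def frac_rel_def dest: homD)
  have "(THE x. \<exists>(e, \<rho>)\<in>frac C \<Sigma> f \<sigma>. x = Dom C e) = X"
    by (rule the_equality) (use mem dc in fastforce)+
  moreover have "(THE x. \<exists>(e, \<rho>)\<in>frac C \<Sigma> f \<sigma>. x = Dom C \<rho>) = Y"
    by (rule the_equality) (use mem dc in fastforce)+
  moreover have "frac C \<Sigma> f \<sigma> \<in> fracs C \<Sigma> // frac_rel C \<Sigma>"
    unfolding frac_def using f \<sigma> by (auto intro: quotientI simp: fracs_def hom_def)
  ultimately show ?thesis
    by (simp add: hom_def localization_def)
qed

lemma loc_homE:
  assumes h: "h \<in> hom (localization C \<Sigma>) X Y"
  obtains V f \<sigma> where "f \<in> hom C X V" "\<sigma> \<in> hom C Y V" "\<sigma> \<in> \<Sigma>" "h = frac C \<Sigma> f \<sigma>"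
proof -
  have "h \<in> fracs C \<Sigma> // frac_rel C \<Sigma>" using h by (simp add: hom_def localization_def)
  then obtain f \<sigma> where fs: "(f, \<sigma>) \<in> fracs C \<Sigma>" "h = frac C \<Sigma> f \<sigma>"
    unfolding frac_def by (auto elim: quotientE)
  note hom = fracs_hom[OF fs(1)]
  \<comment> \<open>The class \<open>h\<close> has only one source and one target, so those computed
    from the representative must be \<open>X\<close> and \<open>Y\<close>.\<close>
  from frac_in_hom[OF hom] h fs have "Dom C f = X" "Dom C \<sigma> = Y"
    by (auto simp: hom_def)
  with hom fs that show thesis by metis
qed

text \<open>Evaluates the definite description behind \<open>Comp\<close> with any convenient
  square: every competing value comes from other representatives and another square, and
  \<open>frac_rel_comp\<close> identifies it with this one.\<close>

lemma loc_comp_frac: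
  assumes f: "f \<in> hom C X Y'" and \<sigma>: "\<sigma> \<in> hom C Y Y'" "\<sigma> \<in> \<Sigma>"
    and g: "g \<in> hom C Y Z'" and \<omega>: "\<omega> \<in> hom C Z Z'" "\<omega> \<in> \<Sigma>"
    and g': "g' \<in> hom C Y' V" and \<sigma>': "\<sigma>' \<in> hom C Z' V" "\<sigma>' \<in> \<Sigma>" and sq: "g' \<cdot> \<sigma> = \<sigma>' \<cdot> g"
  shows "frac C \<Sigma> g \<omega> \<cdot>\<^bsub>localization C \<Sigma>\<^esub> frac C \<Sigma> f \<sigma> = frac C \<Sigma> (g' \<cdot> f) (\<sigma>' \<cdot> \<omega>)"
proof -
  let ?P = "\<lambda>H. \<exists>(f, \<sigma>)\<in>frac C \<Sigma> f \<sigma>. \<exists>(g, \<omega>)\<in>frac C \<Sigma> g \<omega>. \<exists>Z g' \<sigma>'.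
    g' \<in> hom C (Cod C \<sigma>) Z \<and> \<sigma>' \<in> hom C (Cod C g) Z \<and> \<sigma>' \<in> \<Sigma> \<and>
    g' \<cdot> \<sigma> = \<sigma>' \<cdot> g \<and> H = frac C \<Sigma> (g' \<cdot> f) (\<sigma>' \<cdot> \<omega>)"
  have mem: "(f, \<sigma>) \<in> frac C \<Sigma> f \<sigma>" "(g, \<omega>) \<in> frac C \<Sigma> g \<omega>"
    using frac_rel_refl[OF f \<sigma>] frac_rel_refl[OF g \<omega>] by (simp_all add: frac_def)
  have cod: "Cod C \<sigma> = Y'" "Cod C g = Z'" using \<sigma> g by (auto dest: homD)
  have "(THE H. ?P H) = frac C \<Sigma> (g' \<cdot> f) (\<sigma>' \<cdot> \<omega>)"
  proof (rule the_equality)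
    show "?P (frac C \<Sigma> (g' \<cdot> f) (\<sigma>' \<cdot> \<omega>))"
      using mem g' \<sigma>' sq unfolding cod[symmetric] by blast
  next
    fix H assume "?P H"
    then obtain e \<rho> h \<tau> U h' \<tau>' where 1: "(e, \<rho>) \<in> frac C \<Sigma> f \<sigma>" "(h, \<tau>) \<in> frac C \<Sigma> g \<omega>"
      and 2: "h' \<in> hom C (Cod C \<rho>) U" "\<tau>' \<in> hom C (Cod C h) U" "\<tau>' \<in> \<Sigma>" "h' \<cdot> \<rho> = \<tau>' \<cdot> h"
      and H: "H = frac C \<Sigma> (h' \<cdot> e) (\<tau>' \<cdot> \<tau>)"
      by blast
    have "((g' \<cdot> f, \<sigma>' \<cdot> \<omega>), (h' \<cdot> e, \<tau>' \<cdot> \<tau>)) \<in> frac_rel C \<Sigma>"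
      using frac_rel_comp[OF assms _ _ 2] 1 by (simp add: frac_def)
    then show "H = frac C \<Sigma> (g' \<cdot> f) (\<sigma>' \<cdot> \<omega>)"
      using frac_eq_iff[OF comp_in_hom[OF f g'] comp_in_hom[OF \<omega>(1) \<sigma>'(1)] comp_in_Sigma[OF \<omega> \<sigma>']]
      by (subst eq_commute) (simp add: H)
  qed
  then show ?thesis by (simp add: localization_def)
qed

lemma loc_comp_in_hom:
  assumes "h \<in> hom (localization C \<Sigma>) X Y" "g \<in> hom (localization C \<Sigma>) Y Z"
  shows "g \<cdot>\<^bsub>localization C \<Sigma>\<^esub> h \<in> hom (localization C \<Sigma>) X Z"
proof -
  obtain Y' f \<sigma> where f: "f \<in> hom C X Y'" and \<sigma>: "\<sigma> \<in> hom C Y Y'" "\<sigma> \<in> \<Sigma>" and h: "h = frac C \<Sigma> f \<sigma>"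
    using loc_homE[OF assms(1)] .
  obtain Z' k \<omega> where k: "k \<in> hom C Y Z'" and \<omega>: "\<omega> \<in> hom C Z Z'" "\<omega> \<in> \<Sigma>" and g: "g = frac C \<Sigma> k \<omega>"
    using loc_homE[OF assms(2)] .
  obtain V a b where a: "a \<in> hom C Y' V" and b: "b \<in> hom C Z' V" "b \<in> \<Sigma>" and ab: "b \<cdot> k = a \<cdot> \<sigma>"
    using ore_square[OF \<sigma> k] .
  show ?thesis
    unfolding g h loc_comp_frac[OF f \<sigma> k \<omega> a b ab[symmetric]]
    using frac_in_hom[OF comp_in_hom[OF f a] comp_in_hom[OF \<omega>(1) b(1)] comp_in_Sigma[OF \<omega> b]] .
qed

text \<open>The denominator of the image of \<open>u\<close> is an identity, so \<open>f\<close> and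
  an identity complete the square and only the numerator changes.\<close>

lemma loc_comp_functor_right:
  assumes u: "u \<in> hom C X Y" and f: "f \<in> hom C Y V" and \<sigma>: "\<sigma> \<in> hom C Z V" "\<sigma> \<in> \<Sigma>"
  shows "frac C \<Sigma> f \<sigma> \<cdot>\<^bsub>localization C \<Sigma>\<^esub> mor_map (loc_functor C \<Sigma>) u = frac C \<Sigma> (f \<cdot> u) \<sigma>"
proof -
  have Y: "Y \<in> Ob C" and V: "V \<in> Ob C" using hom_Ob[OF f] by auto
  have sq: "f \<cdot> Idt C Y = Idt C V \<cdot> f"
    by (simp add: comp_id_right[OF f] comp_id_left[OF f])
  have "Cod C u = Y" using u by (auto dest: homD)
  then show ?thesis
    using loc_comp_frac[OF u id_in_hom[OF Y] LF1_id[OF Y] f \<sigma> f id_in_hom[OF V] LF1_id[OF V] sq]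
    by (simp add: loc_functor_def comp_id_left[OF \<sigma>(1)])
qed

text \<open>Precomposing with the image of \<open>u\<close> leaves the denominator
  \<open>\<sigma>\<close> alone, so one square on \<open>\<sigma>\<close> and \<open>k\<close>
  computes both sides. What remains is associativity in \<open>C\<close>.\<close>

lemma loc_comp_functor_assoc:
  assumes u: "u \<in> hom C X Y" and "h \<in> hom (localization C \<Sigma>) Y Z"
    and "g \<in> hom (localization C \<Sigma>) Z W"
  shows "(g \<cdot>\<^bsub>localization C \<Sigma>\<^esub> h) \<cdot>\<^bsub>localization C \<Sigma>\<^esub> mor_map (loc_functor C \<Sigma>) u
    = g \<cdot>\<^bsub>localization C \<Sigma>\<^esub> (h \<cdot>\<^bsub>localization C \<Sigma>\<^esub> mor_map (loc_functor C \<Sigma>) u)"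
proof -
  obtain Y' f \<sigma> where f: "f \<in> hom C Y Y'" and \<sigma>: "\<sigma> \<in> hom C Z Y'" "\<sigma> \<in> \<Sigma>" and h: "h = frac C \<Sigma> f \<sigma>"
    using loc_homE[OF assms(2)] .
  obtain Z' k \<omega> where k: "k \<in> hom C Z Z'" and \<omega>: "\<omega> \<in> hom C W Z'" "\<omega> \<in> \<Sigma>" and g: "g = frac C \<Sigma> k \<omega>"
    using loc_homE[OF assms(3)] .
  obtain V a b where a: "a \<in> hom C Y' V" and b: "b \<in> hom C Z' V" "b \<in> \<Sigma>" and ab: "b \<cdot> k = a \<cdot> \<sigma>"
    using ore_square[OF \<sigma> k] .
  show ?thesis
    unfolding g h loc_comp_functor_right[OF u f \<sigma>]
      loc_comp_frac[OF f \<sigma> k \<omega> a b ab[symmetric]]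
      loc_comp_frac[OF comp_in_hom[OF u f] \<sigma> k \<omega> a b ab[symmetric]]
      loc_comp_functor_right[OF u comp_in_hom[OF f a] comp_in_hom[OF \<omega>(1) b(1)] comp_in_Sigma[OF \<omega> b]]
    by (simp add: comp_assoc[OF u f a])
qed

section \<open>Cocones over the comma categories\<close>

lemma comma_arrowI:
  assumes "u \<in> hom C A A'" "h' \<in> hom (localization C \<Sigma>) A' B"
    and "h \<in> hom (localization C \<Sigma>) A B"
    and "h' \<cdot>\<^bsub>localization C \<Sigma>\<^esub> mor_map (loc_functor C \<Sigma>) u = h"
  shows "((A, h), u, (A', h')) \<in> Mor (comma C (localization C \<Sigma>) (loc_functor C \<Sigma>) B)"
  using assms hom_Ob[OF assms(1)] by (simp add: comma_def Let_def loc_functor_def)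

text \<open>Unfolds the encoding of comma arrows as triples once, for an arbitrary cocone; it serves
  the pushforward below as well as the final formula.\<close>

lemma cocone_chi_arrow:
  assumes cocone: "is_cocone (comma C (localization C \<Sigma>) (loc_functor C \<Sigma>) B) S (chi X) c \<mu>"
    and "u \<in> hom C A A'" "h' \<in> hom (localization C \<Sigma>) A' B"
    and "h \<in> hom (localization C \<Sigma>) A B"
    and "h' \<cdot>\<^bsub>localization C \<Sigma>\<^esub> mor_map (loc_functor C \<Sigma>) u = h"
  shows "\<mu> (A', h') \<cdot>\<^bsub>S\<^esub> mor_map X u = \<mu> (A, h)"
proof -
  let ?J = "comma C (localization C \<Sigma>) (loc_functor C \<Sigma>) B"
  have "\<mu> (Cod ?J v) \<cdot>\<^bsub>S\<^esub> mor_map (chi X) v = \<mu> (Dom ?J v)"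
    if "v \<in> Mor ?J" for v
    using cocone that unfolding is_cocone_def by blast
  from this[OF comma_arrowI[OF assms(2-5)]] show ?thesis
    by (simp add: comma_def Let_def chi_def ftr_comp_def comma_proj_def)
qed

text \<open>Postcomposition with \<open>g\<close> maps the comma category over \<open>B\<close> to
  the one over \<open>B'\<close> without touching the underlying arrows of \<open>C\<close>, so
  cocones restrict along it. The restricted cocone is the one that induces the Kan extension on
  \<open>g\<close>.\<close>

lemma cocone_chi_pushforward:
  assumes g: "g \<in> hom (localization C \<Sigma>) B B'"
    and cocone: "is_cocone (comma C (localization C \<Sigma>) (loc_functor C \<Sigma>) B') S (chi X) c \<mu>"
  shows "is_cocone (comma C (localization C \<Sigma>) (loc_functor C \<Sigma>) B) S (chi X) c
    (\<lambda>(A, h). \<mu> (A, g \<cdot>\<^bsub>localization C \<Sigma>\<^esub> h))"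
    (is "is_cocone ?J S _ c ?\<nu>")
proof -
  have legs: "?\<nu> j \<in> hom S (ob_map (chi X) j) c" if mem: "j \<in> Ob ?J" for j
  proof -
    obtain A h where j: "j = (A, h)" "A \<in> Ob C" "h \<in> hom (localization C \<Sigma>) A B"
      using mem by (auto simp: comma_def Let_def loc_functor_def)
    then have "(A, g \<cdot>\<^bsub>localization C \<Sigma>\<^esub> h) \<in> Ob (comma C (localization C \<Sigma>) (loc_functor C \<Sigma>) B')"
      using loc_comp_in_hom[OF _ g] by (simp add: comma_def Let_def loc_functor_def)
    with cocone have "\<mu> (A, g \<cdot>\<^bsub>localization C \<Sigma>\<^esub> h)
        \<in> hom S (ob_map (chi X) (A, g \<cdot>\<^bsub>localization C \<Sigma>\<^esub> h)) c"
      unfolding is_cocone_def by blast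
    then show ?thesis
      by (simp add: j chi_def ftr_comp_def comma_proj_def)
  qed
  have arrows: "?\<nu> (Cod ?J v) \<cdot>\<^bsub>S\<^esub> mor_map (chi X) v = ?\<nu> (Dom ?J v)" if mem: "v \<in> Mor ?J" for v
  proof -
    obtain A h u A' h' where v: "v = ((A, h), u, (A', h'))" and u: "u \<in> hom C A A'"
      and h': "h' \<in> hom (localization C \<Sigma>) A' B" and h: "h \<in> hom (localization C \<Sigma>) A B"
      and eq: "h' \<cdot>\<^bsub>localization C \<Sigma>\<^esub> mor_map (loc_functor C \<Sigma>) u = h"
      using mem by (auto simp: comma_def Let_def loc_functor_def)
    \<comment> \<open>Restricted associativity makes \<open>u\<close> a comma arrow over
      \<open>B'\<close> from \<open>g \<cdot> h\<close> to \<open>g \<cdot> h'\<close>, where the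
      given cocone identity applies.\<close>
    show ?thesis
      using cocone_chi_arrow[OF cocone u loc_comp_in_hom[OF h' g] loc_comp_in_hom[OF h g]]
        loc_comp_functor_assoc[OF u h' g] eq
      by (simp add: v comma_def Let_def chi_def ftr_comp_def comma_proj_def)
  qed
  have "c \<in> Ob S" using cocone by (simp add: is_cocone_def)
  with legs arrows show ?thesis unfolding is_cocone_def by blast
qed

section \<open>The left Kan extension on arrows and its colimit components\<close>

text \<open>The arrow part of \<open>lan\<close> is a definite description. The universal property
  of the colimit at \<open>B\<close>, applied to the restricted cocone, gives existence and
  uniqueness, so the defining equations may be used.\<close>

lemma lan_comp_eta:
  assumes colim: "is_colimit_choice C (localization C \<Sigma>) S (loc_functor C \<Sigma>) X L \<eta>"
    and B: "B \<in> Ob C" "B' \<in> Ob C"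
    and g: "g \<in> hom (localization C \<Sigma>) B B'"
    and A: "A \<in> Ob C" and h: "h \<in> hom (localization C \<Sigma>) A B"
  shows "mor_map (lan C (localization C \<Sigma>) S (loc_functor C \<Sigma>) L \<eta>) g \<cdot>\<^bsub>S\<^esub> \<eta> B (A, h)
    = \<eta> B' (A, g \<cdot>\<^bsub>localization C \<Sigma>\<^esub> h)"
proof -
  let ?J = "comma C (localization C \<Sigma>) (loc_functor C \<Sigma>)"
  let ?P = "\<lambda>u. u \<in> hom S (L B) (L B') \<and>
    (\<forall>(A, h)\<in>Ob (?J B). u \<cdot>\<^bsub>S\<^esub> \<eta> B (A, h) = \<eta> B' (A, g \<cdot>\<^bsub>localization C \<Sigma>\<^esub> h))"
  have colimB: "is_colimit (?J B) S (chi X) (L B) (\<eta> B)"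
    and colimB': "is_colimit (?J B') S (chi X) (L B') (\<eta> B')"
    using colim B by (auto simp: is_colimit_choice_def localization_def)
  have "is_cocone (?J B) S (chi X) (L B') (\<lambda>(A, h). \<eta> B' (A, g \<cdot>\<^bsub>localization C \<Sigma>\<^esub> h))"
    using colimB' by (intro cocone_chi_pushforward[OF g]) (simp add: is_colimit_def)
  with colimB have "\<exists>!u. u \<in> hom S (L B) (L B') \<and> (\<forall>j\<in>Ob (?J B).
      u \<cdot>\<^bsub>S\<^esub> \<eta> B j = (\<lambda>(A, h). \<eta> B' (A, g \<cdot>\<^bsub>localization C \<Sigma>\<^esub> h)) j)"
    unfolding is_colimit_def by blast
  \<comment> \<open>Reconciles the index \<open>j\<close> of the colimit property with the
    quantifier over pairs in \<open>lan\<close>.\<close>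
  then have "\<exists>!u. ?P u" by (simp add: split_beta)
  then have "?P (THE u. ?P u)" by (rule theI')
  moreover have "mor_map (lan C (localization C \<Sigma>) S (loc_functor C \<Sigma>) L \<eta>) g = (THE u. ?P u)"
    using homD[OF g] by (simp add: lan_def)
  moreover have "(A, h) \<in> Ob (?J B)"
    using A h by (simp add: comma_def Let_def loc_functor_def)
  ultimately show ?thesis by auto
qed

end

theorem mainTheorem1:
  fixes C :: "('o, 'm) cat" and \<Sigma> :: "'m set"
    and S :: "('a, 'b) cat" and X :: "('o, 'm, 'a, 'b) ftr"
    and L :: "'o \<Rightarrow> 'a" and \<eta> :: "'o \<Rightarrow> 'o \<times> ('m \<times> 'm) set \<Rightarrow> 'b"
  assumes "category C" and "left_fractions C \<Sigma>"
    and "category S" and "is_functor C S X"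
    and "is_colimit_choice C (localization C \<Sigma>) S (loc_functor C \<Sigma>) X L \<eta>"
    and "g1 \<in> hom C B W" and "g2 \<in> hom C B' W" and "g2 \<in> \<Sigma>"
    and "\<epsilon> \<in> hom C B A" and "\<epsilon> \<in> \<Sigma>"
    and "g1' \<in> hom C A Z"
    and "\<epsilon>' \<in> hom C W Z" and "\<epsilon>' \<in> \<Sigma>"
    and "g1' \<cdot>\<^bsub>C\<^esub> \<epsilon> = \<epsilon>' \<cdot>\<^bsub>C\<^esub> g1"
  shows "mor_map (lan C (localization C \<Sigma>) S (loc_functor C \<Sigma>) L \<eta>) (frac C \<Sigma> g1 g2)
           \<cdot>\<^bsub>S\<^esub> \<eta> B (A, frac C \<Sigma> (Idt C A) \<epsilon>)
         = \<eta> B' (Z, frac C \<Sigma> (Idt C Z) (\<epsilon>' \<cdot>\<^bsub>C\<^esub> g2)) \<cdot>\<^bsub>S\<^esub> mor_map X g1'"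
proof -
  interpret left_fractions C \<Sigma> by fact
  let ?D = "localization C \<Sigma>"
  let ?Q = "loc_functor C \<Sigma>"
  have B: "B \<in> Ob C" "B' \<in> Ob C" and A: "A \<in> Ob C" and Z: "Z \<in> Ob C"
    using assms(6,7,9,11) hom_Ob by blast+
  have \<sigma>: "\<epsilon>' \<cdot>\<^bsub>C\<^esub> g2 \<in> hom C B' Z" "\<epsilon>' \<cdot>\<^bsub>C\<^esub> g2 \<in> \<Sigma>"
    using comp_in_hom[OF assms(7,12)] comp_in_Sigma[OF assms(7,8,12,13)] .
  have g: "frac C \<Sigma> g1 g2 \<in> hom ?D B B'"
    using frac_in_hom[OF assms(6-8)] .
  have h: "frac C \<Sigma> (Idt C A) \<epsilon> \<in> hom ?D A B"
    using frac_in_hom[OF id_in_hom[OF A] assms(9,10)] .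
  have k: "frac C \<Sigma> (Idt C Z) (\<epsilon>' \<cdot>\<^bsub>C\<^esub> g2) \<in> hom ?D Z B'"
    using frac_in_hom[OF id_in_hom[OF Z] \<sigma>] .
  have gh: "frac C \<Sigma> g1 g2 \<cdot>\<^bsub>?D\<^esub> frac C \<Sigma> (Idt C A) \<epsilon> = frac C \<Sigma> g1' (\<epsilon>' \<cdot>\<^bsub>C\<^esub> g2)"
    using loc_comp_frac[OF id_in_hom[OF A] assms(9,10,6,7,8,11,12,13,14)]
    by (simp add: comp_id_right[OF assms(11)])
  have kQ: "frac C \<Sigma> (Idt C Z) (\<epsilon>' \<cdot>\<^bsub>C\<^esub> g2) \<cdot>\<^bsub>?D\<^esub> mor_map ?Q g1' = frac C \<Sigma> g1' (\<epsilon>' \<cdot>\<^bsub>C\<^esub> g2)"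
    using loc_comp_functor_right[OF assms(11) id_in_hom[OF Z] \<sigma>]
    by (simp add: comp_id_left[OF assms(11)])
  have "is_cocone (comma C ?D ?Q B') S (chi X) (L B') (\<eta> B')"
    using assms(5) B by (simp add: is_colimit_choice_def is_colimit_def localization_def)
  \<comment> \<open>The source of this comma arrow is \<open>A\<close> with the very class computed
    in \<open>gh\<close>, which is where \<open>lan_comp_eta\<close> sends the left-hand
    side.\<close>
  from cocone_chi_arrow[OF this assms(11) k frac_in_hom[OF assms(11) \<sigma>] kQ]
  show ?thesis
    using lan_comp_eta[OF assms(5) B g A h] gh by simp
qed

end
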